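(* Let $S$ be a groupoid satisfying the medial law $(xy)(zw)=(xz)(yw)$. Then $S$ is an inflation of a completely inverse AG**-groupoid if and only if $S^2$ is a completely inverse AG**-groupoid.
   Context: A groupoid is a set with a binary operation. $S^2=\{ab: a,b\in S\}$, with the operation of $S$. An AG-groupoid is a groupoid satisfying $(xy)z=(zy)x$; an AG**-groupoid is an AG-groupoid that also satisfies $x(yz)=y(xz)$. In a groupoid, $b$ is an inverse of $a$ if $(ab)a=a$ and $(ba)b=b$. A groupoid is completely inverse if every element $a$ has a unique inverse $a^{-1}$ (within that groupoid) and $aa^{-1}=a^{-1}a$. $S$ is an inflation of its subgroupoid $U$ if $S$ is a disjoint union of sets $S_u$ ($u\in U$) such that $u\in S_u$ for every $u\in U$, and $ab=uv$ whenever $a\in S_u$ and $b\in S_v$ ($u,v\in U$). *)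

theory Defs
  imports Main "HOL-Library.Disjoint_Sets"
begin

text \<open>
  A groupoid is a carrier set together with an operation that is closed on it. The operation
  is a total HOL function; its values outside the carrier are irrelevant. The carrier may be
  empty.
\<close>

locale groupoid =
  fixes S :: "'a set" and mult :: "'a \<Rightarrow> 'a \<Rightarrow> 'a" (infixl "\<cdot>" 70)
  assumes closed: "x \<in> S \<Longrightarrow> y \<in> S \<Longrightarrow> x \<cdot> y \<in> S"

locale medial_groupoid = groupoid +
  assumes medial:
    "x \<in> S \<Longrightarrow> y \<in> S \<Longrightarrow> z \<in> S \<Longrightarrow> w \<in> S \<Longrightarrow> (x \<cdot> y) \<cdot> (z \<cdot> w) = (x \<cdot> z) \<cdot> (y \<cdot> w)"

locale AG_groupoid = groupoid +
  assumes left_invertive: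
    "x \<in> S \<Longrightarrow> y \<in> S \<Longrightarrow> z \<in> S \<Longrightarrow> (x \<cdot> y) \<cdot> z = (z \<cdot> y) \<cdot> x"

locale AG_star_star_groupoid = AG_groupoid +
  assumes left_exchange:
    "x \<in> S \<Longrightarrow> y \<in> S \<Longrightarrow> z \<in> S \<Longrightarrow> x \<cdot> (y \<cdot> z) = y \<cdot> (x \<cdot> z)"

definition is_inverse :: "('a \<Rightarrow> 'a \<Rightarrow> 'a) \<Rightarrow> 'a \<Rightarrow> 'a \<Rightarrow> bool" where
  "is_inverse m a b \<longleftrightarrow> m (m a b) a = a \<and> m (m b a) b = b"

locale completely_inverse_groupoid = groupoid +
  assumes ex1_inverse: "a \<in> S \<Longrightarrow> \<exists>!b. b \<in> S \<and> is_inverse mult a b"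
    and inverse_commute: "a \<in> S \<Longrightarrow> b \<in> S \<Longrightarrow> is_inverse mult a b \<Longrightarrow> a \<cdot> b = b \<cdot> a"

locale completely_inverse_AG_star_star_groupoid =
  AG_star_star_groupoid + completely_inverse_groupoid

definition square_set :: "'a set \<Rightarrow> ('a \<Rightarrow> 'a \<Rightarrow> 'a) \<Rightarrow> 'a set" where
  "square_set S m = {m a b | a b. a \<in> S \<and> b \<in> S}"

definition subgroupoid :: "'a set \<Rightarrow> 'a set \<Rightarrow> ('a \<Rightarrow> 'a \<Rightarrow> 'a) \<Rightarrow> bool" where
  "subgroupoid U S m \<longleftrightarrow> U \<subseteq> S \<and> groupoid U m"

definition inflation_of :: "'a set \<Rightarrow> ('a \<Rightarrow> 'a \<Rightarrow> 'a) \<Rightarrow> 'a set \<Rightarrow> bool" where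
  "inflation_of S m U \<longleftrightarrow> subgroupoid U S m \<and>
     (\<exists>P :: 'a \<Rightarrow> 'a set.
        S = (\<Union>u\<in>U. P u) \<and> disjoint_family_on P U \<and>
        (\<forall>u\<in>U. u \<in> P u) \<and>
        (\<forall>u\<in>U. \<forall>v\<in>U. \<forall>a\<in>P u. \<forall>b\<in>P v. m a b = m u v))"

end

theory Submission imports Defs
begin

text \<open>
  Call \<open>a \<cdot> a\<inverse>\<close> the support of an element \<open>a\<close> of a completely inverse AG-groupoid. It is an
  idempotent with \<open>support a \<cdot> a = a\<close>, and \<open>support\<close> is an endomorphism because AG-groupoids are
  medial and inverses are unique; hence \<open>a \<cdot> a\<close> has the same support as \<open>a\<close>.

  If \<open>T = S\<^sup>2\<close> is completely inverse, every \<open>a \<in> S\<close> has a square in \<open>T\<close>, although \<open>a\<close> itself may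
  lie outside \<open>T\<close>. So the support of \<open>a\<close> still makes sense as \<open>support (a \<cdot> a)\<close>, and
  \<open>\<phi> a = support (a \<cdot> a) \<cdot> a\<close> is a map \<open>S \<rightarrow> T\<close> that fixes \<open>T\<close> pointwise. The medial law turns
  \<open>\<phi> a \<cdot> \<phi> b\<close> into \<open>(support (a \<cdot> a) \<cdot> support (b \<cdot> b)) \<cdot> (a \<cdot> b)\<close>, whose left factor is the
  support of \<open>(a \<cdot> a) \<cdot> (b \<cdot> b) = (a \<cdot> b) \<cdot> (a \<cdot> b)\<close>, that is, of \<open>a \<cdot> b\<close>. Therefore
  \<open>\<phi> a \<cdot> \<phi> b = a \<cdot> b\<close>, and the fibres of \<open>\<phi>\<close> exhibit \<open>S\<close> as an inflation of \<open>T\<close>.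

  Conversely, in an inflation of \<open>U\<close> every product is a product of elements of \<open>U\<close>, and
  \<open>a = (a \<cdot> a\<inverse>) \<cdot> a\<close> shows that each element of a completely inverse \<open>U\<close> is a product; so
  \<open>S\<^sup>2 = U\<close>.
\<close>

lemma (in AG_groupoid) AG_medial:
  assumes "x \<in> S" "y \<in> S" "z \<in> S" "w \<in> S"
  shows "(x \<cdot> y) \<cdot> (z \<cdot> w) = (x \<cdot> z) \<cdot> (y \<cdot> w)"
proof -
  have "(x \<cdot> y) \<cdot> (z \<cdot> w) = ((z \<cdot> w) \<cdot> y) \<cdot> x"
    using assms by (intro left_invertive closed)
  also have "(z \<cdot> w) \<cdot> y = (y \<cdot> w) \<cdot> z"
    using assms by (intro left_invertive)
  also have "((y \<cdot> w) \<cdot> z) \<cdot> x = (x \<cdot> z) \<cdot> (y \<cdot> w)"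
    using assms by (intro left_invertive closed)
  finally show ?thesis .
qed

context completely_inverse_groupoid
begin

definition inverse_of :: "'a \<Rightarrow> 'a" where
  "inverse_of a = (THE b. b \<in> S \<and> is_inverse (\<cdot>) a b)"

definition support :: "'a \<Rightarrow> 'a" where
  "support a = a \<cdot> inverse_of a"

lemma inverse_of:
  assumes "a \<in> S"
  shows "inverse_of a \<in> S" "is_inverse (\<cdot>) a (inverse_of a)"
  using theI'[OF ex1_inverse[OF assms]] unfolding inverse_of_def by auto

lemma inverse_of_eqI:
  assumes "a \<in> S" "b \<in> S" "is_inverse (\<cdot>) a b"
  shows "inverse_of a = b"
  using ex1_inverse[OF assms(1)] inverse_of[OF assms(1)] assms by blast

lemma support_closed: "a \<in> S \<Longrightarrow> support a \<in> S"
  by (simp add: support_def closed inverse_of)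

lemma support_mult_self: "a \<in> S \<Longrightarrow> support a \<cdot> a = a"
  using inverse_of(2)[of a] by (simp add: support_def is_inverse_def)

lemma subset_square_set: "S \<subseteq> square_set S (\<cdot>)"
proof
  fix a
  assume "a \<in> S"
  then have "a = support a \<cdot> a" "support a \<in> S"
    by (simp_all add: support_mult_self support_closed)
  with \<open>a \<in> S\<close> show "a \<in> square_set S (\<cdot>)"
    unfolding square_set_def by blast
qed

end

context completely_inverse_AG_star_star_groupoid
begin

text \<open>
  Two applications of the medial law split each inverse equation for a product into the
  equations for its factors; uniqueness of inverses does the rest.
\<close>

lemma inverse_of_mult:
  assumes "a \<in> S" "b \<in> S"
  shows "inverse_of (a \<cdot> b) = inverse_of a \<cdot> inverse_of b"
proof (rule inverse_of_eqI)
  have factorwise: "((x \<cdot> y) \<cdot> (z \<cdot> w)) \<cdot> (x \<cdot> y) = ((x \<cdot> z) \<cdot> x) \<cdot> ((y \<cdot> w) \<cdot> y)"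
    if "x \<in> S" "y \<in> S" "z \<in> S" "w \<in> S" for x y z w
    using that by (simp only: AG_medial[of x y z w] AG_medial[of "x \<cdot> z" "y \<cdot> w" x y] closed)
  show "is_inverse (\<cdot>) (a \<cdot> b) (inverse_of a \<cdot> inverse_of b)"
    using assms inverse_of[of a] inverse_of[of b]
    by (simp add: is_inverse_def factorwise)
qed (simp_all add: assms closed inverse_of)

lemma support_mult:
  assumes "a \<in> S" "b \<in> S"
  shows "support (a \<cdot> b) = support a \<cdot> support b"
  using assms by (simp add: support_def inverse_of_mult AG_medial inverse_of)

text \<open>
  With \<open>b\<close> the inverse of \<open>a\<close>, the left invertive law gives
  \<open>(a \<cdot> b) \<cdot> (a \<cdot> b) = ((a \<cdot> b) \<cdot> b) \<cdot> a\<close>; since \<open>a\<close> and \<open>b\<close> commute, this collapses to \<open>b \<cdot> a\<close>.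
\<close>

lemma support_idem:
  assumes "a \<in> S"
  shows "support a \<cdot> support a = support a"
proof -
  let ?b = "inverse_of a"
  have b: "?b \<in> S" "is_inverse (\<cdot>) a ?b"
    using inverse_of[OF assms] by auto
  have comm: "a \<cdot> ?b = ?b \<cdot> a"
    using inverse_commute[OF assms b] .
  have "(a \<cdot> ?b) \<cdot> (a \<cdot> ?b) = ((a \<cdot> ?b) \<cdot> ?b) \<cdot> a"
    using assms b by (intro left_invertive closed)
  also have "\<dots> = ((?b \<cdot> a) \<cdot> ?b) \<cdot> a"
    by (simp only: comm)
  also have "\<dots> = ?b \<cdot> a"
    using b(2) by (simp add: is_inverse_def)
  finally show ?thesis
    by (simp add: support_def comm)
qed

lemma support_square: "a \<in> S \<Longrightarrow> support (a \<cdot> a) = support a"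
  by (simp add: support_mult support_idem)

end

lemma square_set_inflation_subset:
  assumes "inflation_of S m U"
  shows "square_set S m \<subseteq> U"
proof -
  from assms obtain P where
    S: "S = (\<Union>u\<in>U. P u)"
    and P: "\<forall>u\<in>U. \<forall>v\<in>U. \<forall>a\<in>P u. \<forall>b\<in>P v. m a b = m u v"
    and U: "groupoid U m"
    unfolding inflation_of_def subgroupoid_def by blast
  interpret groupoid U m by (rule U)
  show ?thesis
  proof
    fix x
    assume "x \<in> square_set S m"
    then obtain u v a b where "u \<in> U" "v \<in> U" "a \<in> P u" "b \<in> P v" "x = m a b"
      unfolding square_set_def S by blast
    with P have "x = m u v"
      by blast
    with \<open>u \<in> U\<close> \<open>v \<in> U\<close> show "x \<in> U"
      by (simp add: closed)
  qed
qed

lemma square_set_mono: "U \<subseteq> S \<Longrightarrow> square_set U m \<subseteq> square_set S m"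
  unfolding square_set_def by blast

lemma square_set_inflation_completely_inverse:
  assumes "inflation_of S m U" "completely_inverse_groupoid U m"
  shows "square_set S m = U"
proof
  show "square_set S m \<subseteq> U"
    using assms(1) by (rule square_set_inflation_subset)
  have "U \<subseteq> square_set U m"
    using assms(2) by (rule completely_inverse_groupoid.subset_square_set)
  also have "\<dots> \<subseteq> square_set S m"
    using assms(1) by (intro square_set_mono) (simp add: inflation_of_def subgroupoid_def)
  finally show "U \<subseteq> square_set S m" .
qed

text \<open>
  Take the fibres of the retraction \<open>f\<close> as the classes of the inflation.
\<close>

lemma inflation_of_retraction:
  assumes "subgroupoid U S m"
    and "\<And>a. a \<in> S \<Longrightarrow> f a \<in> U"
    and "\<And>u. u \<in> U \<Longrightarrow> f u = u"
    and "\<And>a b. a \<in> S \<Longrightarrow> b \<in> S \<Longrightarrow> m a b = m (f a) (f b)"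
  shows "inflation_of S m U"
  unfolding inflation_of_def
proof (intro conjI exI[of _ "\<lambda>u. {a \<in> S. f a = u}"])
  have "U \<subseteq> S"
    using assms(1) by (simp add: subgroupoid_def)
  then show "\<forall>u\<in>U. u \<in> {a \<in> S. f a = u}"
    using assms(3) by blast
  show "\<forall>u\<in>U. \<forall>v\<in>U. \<forall>a\<in>{a \<in> S. f a = u}. \<forall>b\<in>{a \<in> S. f a = v}. m a b = m u v"
    using assms(4) by blast
qed (use assms(1,2) in \<open>auto simp: disjoint_family_on_def\<close>)

lemma inflation_of_square_set:
  assumes "medial_groupoid S m"
    and "completely_inverse_AG_star_star_groupoid (square_set S m) m"
  shows "inflation_of S m (square_set S m)"
proof -
  let ?T = "square_set S m"
  interpret S: medial_groupoid S m by (rule assms(1))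
  interpret T: completely_inverse_AG_star_star_groupoid ?T m by (rule assms(2))
  have T_sub: "?T \<subseteq> S"
    unfolding square_set_def using S.closed by blast
  have T_mult: "m a b \<in> ?T" if "a \<in> S" "b \<in> S" for a b
    unfolding square_set_def using that by blast
  have supp: "T.support (m a a) \<in> S" if "a \<in> S" for a
    using T.support_closed[OF T_mult[OF that that]] T_sub by blast
  define f where "f = (\<lambda>a. m (T.support (m a a)) a)"
  show ?thesis
  proof (rule inflation_of_retraction[where f = f])
    show "subgroupoid ?T S m"
      using T_sub T.groupoid_axioms by (simp add: subgroupoid_def)
    show "f a \<in> ?T" if "a \<in> S" for a
      using that supp T_mult by (simp add: f_def)
    show "f u = u" if "u \<in> ?T" for u
      using that by (simp add: f_def T.support_square T.support_mult_self)
    show "m a b = m (f a) (f b)" if ab: "a \<in> S" "b \<in> S" for a b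
    proof -
      have "m (f a) (f b) = m (m (T.support (m a a)) (T.support (m b b))) (m a b)"
        unfolding f_def using ab supp by (intro S.medial)
      also have "m (T.support (m a a)) (T.support (m b b)) = T.support (m (m a a) (m b b))"
        using ab T_mult by (simp add: T.support_mult)
      also have "m (m a a) (m b b) = m (m a b) (m a b)"
        using ab by (intro S.medial)
      also have "T.support (m (m a b) (m a b)) = T.support (m a b)"
        using ab T_mult by (intro T.support_square)
      also have "m (T.support (m a b)) (m a b) = m a b"
        using ab T_mult by (intro T.support_mult_self)
      finally show ?thesis by simp
    qed
  qed
qed

theorem theorem10:
  fixes S :: "'a set" and m :: "'a \<Rightarrow> 'a \<Rightarrow> 'a"
  assumes "medial_groupoid S m"
  shows "(\<exists>U. inflation_of S m U \<and> completely_inverse_AG_star_star_groupoid U m)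
    \<longleftrightarrow> completely_inverse_AG_star_star_groupoid (square_set S m) m"
proof
  assume "\<exists>U. inflation_of S m U \<and> completely_inverse_AG_star_star_groupoid U m"
  then obtain U where U: "inflation_of S m U" "completely_inverse_AG_star_star_groupoid U m"
    by blast
  have "square_set S m = U"
    using U(1) completely_inverse_AG_star_star_groupoid.axioms(2)[OF U(2)]
    by (rule square_set_inflation_completely_inverse)
  with U(2) show "completely_inverse_AG_star_star_groupoid (square_set S m) m"
    by simp
next
  assume "completely_inverse_AG_star_star_groupoid (square_set S m) m"
  with inflation_of_square_set[OF assms this]
  show "\<exists>U. inflation_of S m U \<and> completely_inverse_AG_star_star_groupoid U m"
    by blast
qed

end
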